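(* There exist universal constants $c,C>0$ such that for every $n\ge 1$, every convex bounded domain $K$ in $(\mathbb{R}^n,|\cdot|)$ and every $w>0$, $$w\le\frac{c}{E_2 S}\quad\Longrightarrow\quad \frac{Z_K(w)}{w}\ \ge\ \frac12E_2^2-C\,E_2 S.$$
   Context: $|\cdot|$ is the Euclidean norm on $\mathbb{R}^n$. A domain is a nonempty connected open set. $\mu_K$ denotes the uniform probability measure on $K$ (normalized Lebesgue measure), and $X$ is a random vector distributed according to $\mu_K$. Set $E_2:=\sqrt{\mathbb{E}(|X|^2)}$ and $S:=\sqrt{\mathbb{E}\big((|X|-\mathbb{E}|X|)^2\big)}$ (no assumption is made on the position of $K$ relative to the origin). For $w\ge 0$, $$Z_K(w):=-\log\int \exp\Big(-\frac w2|x|^2\Big)\,d\mu_K(x).$$ "Universal" means that the constants do not depend on $n$, $K$, $w$ or anything else. *)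

theory Defs
  imports "HOL-Analysis.Analysis"
begin

(* The constants in the theorem are uniform in the dimension, so n must be a natural number that
   can be quantified inside the formula, not the cardinality of an index type.  R^n is therefore
   the set of functions {..<n} -> real, as extensional functions on nat, which is at once the
   carrier of the library's finite product topology and of its finite product measure. *)

definition euclid_top :: "nat \<Rightarrow> (nat \<Rightarrow> real) topology" where
  "euclid_top n = product_topology (\<lambda>_. euclideanreal) {..<n}"

definition lborel_n :: "nat \<Rightarrow> (nat \<Rightarrow> real) measure" where
  "lborel_n n = (\<Pi>\<^sub>M i\<in>{..<n}. (lborel :: real measure))"

definition enorm :: "nat \<Rightarrow> (nat \<Rightarrow> real) \<Rightarrow> real" where
  "enorm n x = L2_set x {..<n}"

(* restrict keeps the convex combination extensional, i.e. inside the carrier. *)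
definition convex_n :: "nat \<Rightarrow> (nat \<Rightarrow> real) set \<Rightarrow> bool" where
  "convex_n n K \<longleftrightarrow>
     (\<forall>x\<in>K. \<forall>y\<in>K. \<forall>t\<in>{0..1}. (\<lambda>i\<in>{..<n}. (1 - t) * x i + t * y i) \<in> K)"

definition bounded_n :: "nat \<Rightarrow> (nat \<Rightarrow> real) set \<Rightarrow> bool" where
  "bounded_n n K \<longleftrightarrow> (\<exists>R. \<forall>x\<in>K. enorm n x \<le> R)"

definition domain_n :: "nat \<Rightarrow> (nat \<Rightarrow> real) set \<Rightarrow> bool" where
  "domain_n n K \<longleftrightarrow> K \<noteq> {} \<and> openin (euclid_top n) K \<and> connectedin (euclid_top n) K"

(* For a bounded domain K, the volume of K is positive and finite, so this is a probability
   measure. *)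
definition unif :: "nat \<Rightarrow> (nat \<Rightarrow> real) set \<Rightarrow> (nat \<Rightarrow> real) measure" where
  "unif n K = uniform_measure (lborel_n n) K"

(* Expectations of functions of X are integrals with respect to the law unif n K of X. *)
definition E2 :: "nat \<Rightarrow> (nat \<Rightarrow> real) set \<Rightarrow> real" where
  "E2 n K = sqrt (\<integral>x. (enorm n x)\<^sup>2 \<partial>unif n K)"

definition S :: "nat \<Rightarrow> (nat \<Rightarrow> real) set \<Rightarrow> real" where
  "S n K = sqrt (\<integral>x. (enorm n x - (\<integral>y. enorm n y \<partial>unif n K))\<^sup>2 \<partial>unif n K)"

definition Z :: "nat \<Rightarrow> (nat \<Rightarrow> real) set \<Rightarrow> real \<Rightarrow> real" where
  "Z n K w = - ln (\<integral>x. exp (- (w / 2) * (enorm n x)\<^sup>2) \<partial>unif n K)"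

end

theory Submission
  imports Defs "HOL-Probability.Probability_Measure"
begin

text \<open>Write \<open>Y = |X|\<close>, let \<open>m\<close> be its mean and \<open>V = max 0 (m - Y)\<close> its lower deviation. As \<open>E2\<^sup>2 = m\<^sup>2 + S\<^sup>2\<close> and
\<open>m\<^sup>2 - Y\<^sup>2 \<le> 2 * m * V\<close>, the claim follows once the exponential moment of \<open>V\<close> at \<open>\<theta> = w * m\<close> is at most
\<open>exp (C * \<theta> * S)\<close>, for all \<open>\<theta>\<close> up to a constant over \<open>S\<close>. So \<open>Y\<close> must have exponential lower tails at the scale
of its standard deviation, with constants that do not depend on the dimension.

These tails come from log-concavity of the distribution function \<open>F r\<close>, the probability of \<open>Y \<le> r\<close>. Its values
are proportional to the volumes of the intersections of \<open>K\<close> with balls about the origin, and midpoints of two such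
sets lie in the intersection for the mean radius (\<open>unif_centred_balls_midpoint_log_concave\<close>). The volume of the
set of midpoints is controlled by the multiplicative Brunn--Minkowski inequality, which is the indicator case of
the Prekopa--Leindler inequality with weight one half (\<open>prekopa_leindler_PiM\<close>). Unlike an argument by
contracting \<open>K\<close> towards a point, it loses no factor depending on the dimension. Its functional form
is what allows an induction on the coordinates, starting from the line.

Chebyshev's inequality provides one gap, between \<open>m - 2 * S\<close> and \<open>m + 2 * S\<close>, over which \<open>F\<close> drops by a factor of
three towards the left. Log-concavity repeats this drop at every further step of length \<open>4 * S\<close>, which bounds
the exponential moment of \<open>V\<close> at \<open>1 / (8 * S)\<close> by an absolute constant (\<open>exp_lower_deviation_bound\<close>).
Convexity of \<open>exp\<close> interpolates between this exponent and zero (\<open>ln_expectation_exp_neg_square_le\<close>).\<close>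

section \<open>The Prekopa--Leindler inequality on the line\<close>

text \<open>Exhausting a set of reals by a monotone sequence of its own points lets one cut the set at points that
belong to it. When there is no maximum, one point above each rational gives a countable cofinal subset,
and running maxima make it monotone.\<close>

lemma cofinal_sequence:
  fixes A :: "real set"
  assumes "A \<noteq> {}"
  obtains a :: "nat \<Rightarrow> real" where "incseq a" "\<And>n. a n \<in> A" "\<And>x. x \<in> A \<Longrightarrow> \<exists>n. x \<le> a n"
proof (cases "\<exists>m\<in>A. \<forall>x\<in>A. x \<le> m")
  case True
  then obtain m where "m \<in> A" "\<forall>x\<in>A. x \<le> m" by blast
  then show ?thesis using that[of "\<lambda>_. m"] by auto
next
  case False
  define above where "above q = (SOME y. y \<in> A \<and> q < y)" for q :: real
  define D where "D = above ` {q \<in> \<rat>. \<exists>y\<in>A. q < y}"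
  have above: "above q \<in> A \<and> q < above q" if "\<exists>y\<in>A. q < y" for q
    unfolding above_def using that by (intro someI_ex[of "\<lambda>y. y \<in> A \<and> q < y"]) blast
  have cofinal: "\<exists>d\<in>D. x \<le> d" if "x \<in> A" for x
  proof -
    obtain y where y: "y \<in> A" "x < y" using False \<open>x \<in> A\<close> by (meson not_le)
    obtain q where q: "q \<in> \<rat>" "x < q" "q < y" using Rats_dense_in_real[OF y(2)] by blast
    then have "above q \<in> D" "q < above q" using above[of q] y by (auto simp: D_def)
    then show ?thesis using q by (intro bexI[of _ "above q"]) auto
  qed
  have D: "D \<subseteq> A" "countable D" "D \<noteq> {}"

  proof -
    show "D \<subseteq> A" using above by (auto simp: D_def)
    show "countable D" unfolding D_def
      by (intro countable_image countable_subset[OF _ countable_rat]) auto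
    show "D \<noteq> {}" using cofinal assms by blast
  qed
  define a where "a n = Max (from_nat_into D ` {..n})" for n
  show ?thesis
  proof
    show "incseq a" unfolding a_def by (intro monoI Max_mono) auto
    show "a n \<in> A" for n
    proof -
      have "a n \<in> from_nat_into D ` {..n}" unfolding a_def by (intro Max_in) auto
      then obtain k where "a n = from_nat_into D k" by blast
      then show ?thesis using from_nat_into[OF D(3), of k] D(1) by auto
    qed
    show "\<exists>n. x \<le> a n" if x: "x \<in> A" for x
    proof -
      obtain d where d: "d \<in> D" "x \<le> d" using cofinal[OF x] by blast
      obtain n where n: "d = from_nat_into D n" using D d by (metis from_nat_into_surj)
      have "d \<le> a n" unfolding a_def n by (intro Max_ge) auto
      then show ?thesis using d by (meson order_trans)
    qed
  qed
qed

text \<open>The additive Brunn--Minkowski inequality on the line, with weight one half. For \<open>a \<in> A\<close> and \<open>b \<in> B\<close>, the part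
of \<open>A\<close> to the left of \<open>a\<close>, averaged with \<open>b\<close>, lies in \<open>C\<close> to the left of \<open>(a + b) / 2\<close>, and the part of \<open>B\<close> to
the right of \<open>b\<close>, averaged with \<open>a\<close>, lies in \<open>C\<close> to the right of it. These two copies, of half the size,
overlap in at most one point. Letting \<open>a\<close> move to the right through \<open>A\<close> and \<open>b\<close> to the left through \<open>B\<close>
exhausts both sets.\<close>

lemma measure_midpoint_set_line:
  fixes A B C :: "real set"
  assumes [measurable]: "A \<in> sets borel" "B \<in> sets borel" "C \<in> sets borel"
    and "A \<noteq> {}" "B \<noteq> {}"
    and mid: "\<And>a b. a \<in> A \<Longrightarrow> b \<in> B \<Longrightarrow> (a + b) / 2 \<in> C"
  shows "emeasure lborel A + emeasure lborel B \<le> 2 * emeasure lborel C"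
proof -
  have cut: "emeasure lborel (A \<inter> {..a}) + emeasure lborel (B \<inter> {b..}) \<le> 2 * emeasure lborel C"
    if a: "a \<in> A" and b: "b \<in> B" for a b
  proof -
    \<comment> \<open>Substituting \<open>2 * z - r\<close> turns the measure of \<open>T\<close> into twice that of its averages with \<open>r\<close>.\<close>
    have half: "emeasure lborel T = 2 * (\<integral>\<^sup>+z. indicator T (- r + 2 * z) \<partial>lborel)"
      if [measurable]: "T \<in> sets borel" for T and r :: real
      using nn_integral_real_affine[of "indicator T" 2 "- r"] by simp
    have "emeasure lborel (A \<inter> {..a}) + emeasure lborel (B \<inter> {b..})
       = 2 * (\<integral>\<^sup>+z. indicator (A \<inter> {..a}) (- b + 2 * z) + indicator (B \<inter> {b..}) (- a + 2 * z) \<partial>lborel)"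
      by (subst half[of _ b], simp, subst half[of _ a], simp)
         (simp add: nn_integral_add distrib_left)
    also have "\<dots> \<le> 2 * (\<integral>\<^sup>+z. indicator C z \<partial>lborel)"
    proof (intro mult_left_mono nn_integral_mono_AE)
      show "AE z in lborel. indicator (A \<inter> {..a}) (- b + 2 * z) + indicator (B \<inter> {b..}) (- a + 2 * z)
              \<le> (indicator C z :: ennreal)"
        using AE_lborel_singleton[of "(a + b) / 2"]
      proof eventually_elim
        case (elim z)
        have "z \<in> C" if "- b + 2 * z \<in> A" using mid[OF that b] by simp
        moreover have "z \<in> C" if "- a + 2 * z \<in> B" using mid[OF a that] by simp
        ultimately show ?case using elim by (auto simp: indicator_def field_simps)
      qed
    qed simp
    finally show ?thesis by simp
  qed
  obtain a where a: "incseq a" "\<And>n. a n \<in> A" "\<And>x. x \<in> A \<Longrightarrow> \<exists>n. x \<le> a n"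
    using cofinal_sequence[OF \<open>A \<noteq> {}\<close>] by blast
  obtain b where b: "incseq b" "\<And>n. b n \<in> uminus ` B" "\<And>x. x \<in> uminus ` B \<Longrightarrow> \<exists>n. x \<le> b n"
    using cofinal_sequence[of "uminus ` B"] \<open>B \<noteq> {}\<close> by blast
  have incA: "incseq (\<lambda>n. A \<inter> {..a n})"
    using a(1) by (auto simp: incseq_def intro: order_trans)
  have incB: "incseq (\<lambda>n. B \<inter> {- b n..})"
    using b(1) by (auto simp: incseq_def) (meson neg_le_iff_le order_trans)
  have "A = (\<Union>n. A \<inter> {..a n})" using a(3) by auto
  then have A: "emeasure lborel A = (SUP n. emeasure lborel (A \<inter> {..a n}))"
    by (subst SUP_emeasure_incseq[OF _ incA]) auto
  have "B = (\<Union>n. B \<inter> {- b n..})" using b(3) by (auto simp: minus_le_iff)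
  then have B: "emeasure lborel B = (SUP n. emeasure lborel (B \<inter> {- b n..}))"
    by (subst SUP_emeasure_incseq[OF _ incB]) auto
  have "emeasure lborel A + emeasure lborel B
      = (SUP n. emeasure lborel (A \<inter> {..a n}) + emeasure lborel (B \<inter> {- b n..}))"
    unfolding A B
    by (intro ennreal_SUP_add[symmetric] monoI emeasure_mono incseqD[OF incA] incseqD[OF incB]) auto
  also have "\<dots> \<le> 2 * emeasure lborel C"
    using a(2) b(2) by (intro SUP_least cut) (auto simp: image_iff, metis minus_minus)
  finally show ?thesis .
qed

lemma nn_integral_layer_cake_unit:
  fixes f :: "real \<Rightarrow> real"
  assumes [measurable]: "f \<in> borel_measurable borel" and f: "\<And>x. 0 \<le> f x" "\<And>x. f x \<le> 1"
  shows "(\<integral>\<^sup>+x. ennreal (f x) \<partial>lborel)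
       = (\<integral>\<^sup>+t. emeasure lborel {x. t < f x} * indicator {0<..<1} t \<partial>lborel)"
proof -
  have "(\<integral>\<^sup>+x. ennreal (f x) \<partial>lborel)
      = (\<integral>\<^sup>+x. (\<integral>\<^sup>+t. indicator {x. t < f x} x * indicator {0<..<1} t \<partial>lborel) \<partial>lborel)"
  proof (intro nn_integral_cong)
    fix x
    have "(\<integral>\<^sup>+t. indicator {x. t < f x} x * indicator {0<..<1} t \<partial>lborel)
        = (\<integral>\<^sup>+t. indicator {0<..<f x} t \<partial>lborel)"
      using f(2)[of x] by (intro nn_integral_cong) (auto simp: indicator_def)
    also have "\<dots> = ennreal (f x)" using f(1)[of x] by simp
    finally show "ennreal (f x) = (\<integral>\<^sup>+t. indicator {x. t < f x} x * indicator {0<..<1} t \<partial>lborel)"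
      by simp
  qed
  also have "\<dots> = (\<integral>\<^sup>+t. (\<integral>\<^sup>+x. indicator {x. t < f x} x * indicator {0<..<1} t \<partial>lborel) \<partial>lborel)"
    by (intro lborel_pair.Fubini') (simp add: indicator_def)
  also have "\<dots> = (\<integral>\<^sup>+t. emeasure lborel {x. t < f x} * indicator {0<..<1} t \<partial>lborel)"
    by (simp add: nn_integral_multc)
  finally show ?thesis .
qed

text \<open>If \<open>f\<close> and \<open>g\<close> both have supremum one, then for \<open>0 < t < 1\<close> their superlevel sets at height \<open>t\<close> are nonempty
and have all their midpoints in the superlevel set of \<open>h\<close>. Integrating the one-dimensional set inequality
over \<open>t\<close> gives even the arithmetic-mean form of the conclusion. Equal suprema are essential here: they
keep the two level sets nonempty for the same range of \<open>t\<close>.\<close>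

lemma prekopa_leindler_line_normalized:
  fixes f g h :: "real \<Rightarrow> real"
  assumes [measurable]: "f \<in> borel_measurable borel" "g \<in> borel_measurable borel"
      "h \<in> borel_measurable borel"
    and f: "\<And>x. 0 \<le> f x" "\<And>x. f x \<le> 1" "\<And>t. t < 1 \<Longrightarrow> \<exists>x. t < f x"
    and g: "\<And>x. 0 \<le> g x" "\<And>x. g x \<le> 1" "\<And>t. t < 1 \<Longrightarrow> \<exists>x. t < g x"
    and h: "\<And>x. 0 \<le> h x" "\<And>x. h x \<le> 1"
    and mid: "\<And>x y. f x * g y \<le> (h ((x + y) / 2))\<^sup>2"
  shows "(\<integral>\<^sup>+x. ennreal (f x) \<partial>lborel) + (\<integral>\<^sup>+x. ennreal (g x) \<partial>lborel)
       \<le> 2 * (\<integral>\<^sup>+x. ennreal (h x) \<partial>lborel)"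
proof -
  have level: "emeasure lborel {x. t < f x} + emeasure lborel {x. t < g x}
      \<le> 2 * emeasure lborel {x. t < h x}" if t: "0 < t" "t < 1" for t
  proof (rule measure_midpoint_set_line)
    fix x y assume "x \<in> {x. t < f x}" "y \<in> {x. t < g x}"
    then have "t * t < f x * g y" using t by (intro mult_strict_mono) auto
    then have "t\<^sup>2 < (h ((x + y) / 2))\<^sup>2" using mid[of x y] by (simp add: power2_eq_square)
    then show "(x + y) / 2 \<in> {x. t < h x}" using h(1) by (auto intro: power_less_imp_less_base)
  qed (use f(3) g(3) t in auto)
  have [measurable]: "(\<lambda>t. emeasure lborel {x. t < u x}) \<in> borel_measurable borel"
    if [measurable]: "u \<in> borel_measurable borel" for u :: "real \<Rightarrow> real"
    by measurable
  have "(\<integral>\<^sup>+x. ennreal (f x) \<partial>lborel) + (\<integral>\<^sup>+x. ennreal (g x) \<partial>lborel)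
      = (\<integral>\<^sup>+t. emeasure lborel {x. t < f x} * indicator {0<..<1} t
           + emeasure lborel {x. t < g x} * indicator {0<..<1} t \<partial>lborel)"
    by (simp add: nn_integral_layer_cake_unit f g nn_integral_add)
  also have "\<dots> \<le> (\<integral>\<^sup>+t. 2 * (emeasure lborel {x. t < h x} * indicator {0<..<1} t) \<partial>lborel)"
    by (intro nn_integral_mono) (auto simp: indicator_def level)
  also have "\<dots> = 2 * (\<integral>\<^sup>+x. ennreal (h x) \<partial>lborel)"
    by (simp add: nn_integral_layer_cake_unit h nn_integral_cmult)
  finally show ?thesis .
qed

lemma ennreal_mult_le_square_of_mean:
  fixes u v w :: ennreal
  assumes "u + v \<le> 2 * w"
  shows "u * v \<le> w\<^sup>2"
proof (cases "w = top")
  case True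
  then show ?thesis by (simp add: power2_eq_square ennreal_mult_top)
next
  case False
  then have "u + v < top"
    by (intro order.strict_trans1[OF assms]) (simp add: ennreal_mult_less_top less_top)
  then have "u \<noteq> top" "v \<noteq> top" by auto
  then obtain a b c where abc: "u = ennreal a" "v = ennreal b" "w = ennreal c" "0 \<le> a" "0 \<le> b" "0 \<le> c"
    using False by (cases u; cases v; cases w) auto
  have "ennreal (a + b) \<le> ennreal (2 * c)"
    using assms abc by (simp add: ennreal_mult)
  then have "a + b \<le> 2 * c" using abc by (subst (asm) ennreal_le_iff) auto
  then have "(a + b)\<^sup>2 \<le> (2 * c)\<^sup>2" using abc by (intro power_mono) auto
  moreover have "(a + b)\<^sup>2 - 4 * (a * b) = (a - b)\<^sup>2" by (simp add: power2_eq_square algebra_simps)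
  moreover have "0 \<le> (a - b)\<^sup>2" by simp
  moreover have "(2 * c)\<^sup>2 = 4 * c\<^sup>2" by (simp add: power_mult_distrib)
  ultimately have "a * b \<le> c\<^sup>2" by linarith
  then show ?thesis using abc by (simp add: ennreal_leI ennreal_power flip: ennreal_mult)
qed

text \<open>Dividing by the supremum prepares a bounded function for the normalized inequality.\<close>

lemma normalize_by_supremum:
  fixes u :: "'a \<Rightarrow> ennreal"
  assumes sup: "(SUP x. u x) = ennreal c" and c: "0 < c"
  shows "u x = ennreal c * ennreal (enn2real (u x) / c)"
    and "enn2real (u x) / c \<le> 1"
    and "t < 1 \<Longrightarrow> \<exists>x. t < enn2real (u x) / c"
proof -
  have le: "u x \<le> ennreal c" for x using SUP_upper[of x UNIV u] sup by simp
  show eq: "u x = ennreal c * ennreal (enn2real (u x) / c)" for x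
    using le[of x] c by (cases "u x") (auto simp: ennreal_mult[symmetric] top_unique)
  show "enn2real (u x) / c \<le> 1" using le[of x] c by (simp add: enn2real_leI)
  show "\<exists>x. t < enn2real (u x) / c" if "t < 1"
  proof (rule ccontr)
    assume *: "\<nexists>x. t < enn2real (u x) / c"
    have "0 \<le> t" using * c by (meson divide_nonneg_pos enn2real_nonneg not_less order_trans)
    have "u x \<le> ennreal (c * t)" for x
      using * c by (subst eq) (auto simp: ennreal_mult[symmetric] not_less pos_divide_le_eq mult.commute intro!: ennreal_leI)
    then have "ennreal c \<le> ennreal (c * t)" unfolding sup[symmetric] by (intro SUP_least)
    then have "c \<le> c * t" using c \<open>0 \<le> t\<close> by (subst (asm) ennreal_le_iff) auto
    then show False using c \<open>t < 1\<close> by simp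
  qed
qed

text \<open>The conclusion scales correctly when \<open>f\<close>, \<open>g\<close> and \<open>h\<close> are divided by \<open>a\<close>, \<open>b\<close> and \<open>sqrt (a * b)\<close>, so the
suprema can be made one. The arithmetic-mean form then weakens to the product form, which is the one that
survives unscaling.\<close>

lemma prekopa_leindler_line_bounded:
  fixes f g h :: "real \<Rightarrow> ennreal"
  assumes [measurable]: "f \<in> borel_measurable borel" "g \<in> borel_measurable borel"
      "h \<in> borel_measurable borel"
    and bnd: "(SUP x. f x) < top" "(SUP x. g x) < top"
    and mid: "\<And>x y. f x * g y \<le> (h ((x + y) / 2))\<^sup>2"
  shows "(\<integral>\<^sup>+x. f x \<partial>lborel) * (\<integral>\<^sup>+x. g x \<partial>lborel) \<le> (\<integral>\<^sup>+x. h x \<partial>lborel)\<^sup>2"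
proof (cases "(SUP x. f x) = 0 \<or> (SUP x. g x) = 0")
  case True
  then have "(\<forall>x. f x = 0) \<or> (\<forall>x. g x = 0)"
    by (metis SUP_upper UNIV_I bot.extremum_uniqueI bot_ennreal)
  then show ?thesis by auto
next
  case False
  obtain a b where ab: "(SUP x. f x) = ennreal a" "(SUP x. g x) = ennreal b" "0 < a" "0 < b"
    using bnd False by (metis ennreal_cases ennreal_0 less_irrefl order_le_less)
  \<comment> \<open>Since \<open>s\<^sup>2 = a * b\<close>, capping \<open>h\<close> at \<open>s\<close> keeps the midpoint condition and makes everything finite.\<close>
  define s where "s = sqrt (a * b)"
  have s: "s > 0" "s * s = a * b" using ab by (auto simp: s_def)
  define f1 where "f1 x = enn2real (f x) / a" for x
  define g1 where "g1 x = enn2real (g x) / b" for x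
  define h1 where "h1 x = enn2real (min (ennreal s) (h x)) / s" for x
  note f_norm = normalize_by_supremum[OF ab(1,3), folded f1_def]
  note g_norm = normalize_by_supremum[OF ab(2,4), folded g1_def]
  have f1: "f x = ennreal a * ennreal (f1 x)" for x by (rule f_norm(1))
  have g1: "g x = ennreal b * ennreal (g1 x)" for x by (rule g_norm(1))
  have fa: "f x \<le> ennreal a" for x using SUP_upper[of x UNIV f] ab by simp
  have gb: "g x \<le> ennreal b" for x using SUP_upper[of x UNIV g] ab by simp
  have h1: "min (ennreal s) (h x) = ennreal s * ennreal (h1 x)" for x
  proof -
    have "min (ennreal s) (h x) \<noteq> top" by (auto simp: min_def top_unique)
    then show ?thesis using s unfolding h1_def
      by (cases "min (ennreal s) (h x)") (auto simp: ennreal_mult[symmetric])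
  qed
  have nonneg: "0 \<le> f1 x" "0 \<le> g1 x" "0 \<le> h1 x" for x
    using ab s by (auto simp: f1_def g1_def h1_def)
  have "(\<integral>\<^sup>+x. ennreal (f1 x) \<partial>lborel) + (\<integral>\<^sup>+x. ennreal (g1 x) \<partial>lborel)
       \<le> 2 * (\<integral>\<^sup>+x. ennreal (h1 x) \<partial>lborel)"
  proof (rule prekopa_leindler_line_normalized)
    show "f1 \<in> borel_measurable borel" "g1 \<in> borel_measurable borel" "h1 \<in> borel_measurable borel"
      unfolding f1_def g1_def h1_def by measurable
    show "f1 x \<le> 1" "g1 x \<le> 1" for x by (rule f_norm(2) g_norm(2))+
    show "h1 x \<le> 1" for x using s by (simp add: h1_def enn2real_leI)
    show "\<exists>x. t < f1 x" "\<exists>x. t < g1 x" if "t < 1" for t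
      using f_norm(3) g_norm(3) that by blast+
    show "f1 x * g1 y \<le> (h1 ((x + y) / 2))\<^sup>2" for x y
    proof -
      let ?z = "(x + y) / 2"
      have "f x * g y \<le> (min (ennreal s) (h ?z))\<^sup>2"
      proof (cases "ennreal s \<le> h ?z")
        case True
        have "f x * g y \<le> ennreal a * ennreal b" using fa gb by (intro mult_mono) auto
        also have "\<dots> = (ennreal s)\<^sup>2" using s ab by (simp add: power2_eq_square flip: ennreal_mult)
        finally show ?thesis using True by (simp add: min_def)
      next
        case False
        then show ?thesis using mid[of x y] by (simp add: min_def)
      qed
      then have "ennreal (a * f1 x * (b * g1 y)) \<le> ennreal ((s * h1 ?z)\<^sup>2)"
        unfolding h1 f1 g1 using nonneg ab s
        by (simp add: ennreal_mult[symmetric] ennreal_power)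
      then have "a * f1 x * (b * g1 y) \<le> (s * h1 ?z)\<^sup>2" by (subst (asm) ennreal_le_iff) auto
      then have "(a * b) * (f1 x * g1 y) \<le> (a * b) * (h1 ?z)\<^sup>2"
        unfolding power_mult_distrib power2_eq_square[of s] s(2) by (simp add: mult_ac)
      then show ?thesis using ab by simp
    qed
  qed (rule nonneg)+
  then have key: "(\<integral>\<^sup>+x. ennreal (f1 x) \<partial>lborel) * (\<integral>\<^sup>+x. ennreal (g1 x) \<partial>lborel)
       \<le> (\<integral>\<^sup>+x. ennreal (h1 x) \<partial>lborel)\<^sup>2" by (rule ennreal_mult_le_square_of_mean)
  have [measurable]: "f1 \<in> borel_measurable borel" "g1 \<in> borel_measurable borel" "h1 \<in> borel_measurable borel"
    unfolding f1_def g1_def h1_def by measurable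
  have "(\<integral>\<^sup>+x. f x \<partial>lborel) * (\<integral>\<^sup>+x. g x \<partial>lborel)
      = ennreal a * ennreal b * ((\<integral>\<^sup>+x. ennreal (f1 x) \<partial>lborel) * (\<integral>\<^sup>+x. ennreal (g1 x) \<partial>lborel))"
    unfolding f1 g1 by (simp add: nn_integral_cmult mult_ac)
  also have "ennreal a * ennreal b = (ennreal s)\<^sup>2"
    using s ab by (simp add: power2_eq_square flip: ennreal_mult)
  also have "(ennreal s)\<^sup>2 * ((\<integral>\<^sup>+x. ennreal (f1 x) \<partial>lborel) * (\<integral>\<^sup>+x. ennreal (g1 x) \<partial>lborel))
      \<le> (ennreal s)\<^sup>2 * (\<integral>\<^sup>+x. ennreal (h1 x) \<partial>lborel)\<^sup>2"
    by (intro mult_left_mono key) simp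
  also have "\<dots> = (\<integral>\<^sup>+x. min (ennreal s) (h x) \<partial>lborel)\<^sup>2"
    unfolding h1 by (simp add: nn_integral_cmult power_mult_distrib)
  also have "\<dots> \<le> (\<integral>\<^sup>+x. h x \<partial>lborel)\<^sup>2"
    by (intro power_mono nn_integral_mono) auto
  finally show ?thesis .
qed

lemma nn_integral_eq_SUP_truncation:
  assumes [measurable]: "f \<in> borel_measurable M"
  shows "(\<integral>\<^sup>+x. f x \<partial>M) = (SUP k::nat. \<integral>\<^sup>+x. min (of_nat k) (f x) \<partial>M)"
proof -
  have "(SUP k::nat. min (of_nat k) (f x)) = f x" for x

  proof -
    have "(SUP k::nat. inf (of_nat k) (f x)) = inf (SUP k::nat. of_nat k) (f x)"
      by (rule SUP_inf[symmetric])
    then show ?thesis by (simp add: ennreal_SUP_of_nat_eq_top inf_min)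
  qed
  then have "(\<integral>\<^sup>+x. f x \<partial>M) = (\<integral>\<^sup>+x. (SUP k::nat. min (of_nat k) (f x)) \<partial>M)" by simp
  also have "\<dots> = (SUP k::nat. \<integral>\<^sup>+x. min (of_nat k) (f x) \<partial>M)"
    by (rule nn_integral_monotone_convergence_SUP)
       (auto simp: incseq_def le_fun_def min_le_iff_disj)
  finally show ?thesis .
qed

text \<open>Truncating \<open>f\<close> and \<open>g\<close> preserves the midpoint condition, and the bound does not depend on the truncation
levels. Infinite values have to be covered because in the induction on the dimension the functions on the
line are themselves integrals.\<close>

lemma prekopa_leindler_line:
  fixes f g h :: "real \<Rightarrow> ennreal"
  assumes [measurable]: "f \<in> borel_measurable borel" "g \<in> borel_measurable borel"
      "h \<in> borel_measurable borel"
    and mid: "\<And>x y. f x * g y \<le> (h ((x + y) / 2))\<^sup>2"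
  shows "(\<integral>\<^sup>+x. f x \<partial>lborel) * (\<integral>\<^sup>+x. g x \<partial>lborel) \<le> (\<integral>\<^sup>+x. h x \<partial>lborel)\<^sup>2"
proof -
  have trunc: "(\<integral>\<^sup>+x. min (of_nat k) (f x) \<partial>lborel) * (\<integral>\<^sup>+x. min (of_nat l) (g x) \<partial>lborel)
      \<le> (\<integral>\<^sup>+x. h x \<partial>lborel)\<^sup>2" for k l :: nat
  proof (rule prekopa_leindler_line_bounded)
    have fin: "(SUP x. min (of_nat j) (u x)) < top" for j :: nat and u :: "real \<Rightarrow> ennreal"
    proof -
      have "(SUP x. min (of_nat j) (u x)) \<le> of_nat j" by (intro SUP_least) simp
      also have "\<dots> < top" by (simp add: of_nat_less_top)
      finally show ?thesis .
    qed
    show "(SUP x. min (of_nat k) (f x)) < top" "(SUP x. min (of_nat l) (g x)) < top" by (rule fin)+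
    show "min (of_nat k) (f x) * min (of_nat l) (g y) \<le> (h ((x + y) / 2))\<^sup>2" for x y
      by (rule order_trans[OF mult_mono mid]) auto
  qed measurable
  have f: "(\<integral>\<^sup>+x. f x \<partial>lborel) = (SUP k::nat. \<integral>\<^sup>+x. min (of_nat k) (f x) \<partial>lborel)"
    by (intro nn_integral_eq_SUP_truncation) simp
  have g: "(\<integral>\<^sup>+x. g x \<partial>lborel) = (SUP k::nat. \<integral>\<^sup>+x. min (of_nat k) (g x) \<partial>lborel)"
    by (intro nn_integral_eq_SUP_truncation) simp
  show ?thesis
    unfolding f g SUP_mult_right_ennreal SUP_mult_left_ennreal by (intro SUP_least trunc)
qed

section \<open>The Prekopa--Leindler inequality in several coordinates\<close>

text \<open>Induction on the set of coordinates. For two fixed values of the new coordinate, the induction hypothesis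
applies to the slices of \<open>f\<close> and \<open>g\<close> at these values and the slice of \<open>h\<close> at their midpoint. It
says exactly that the slice integrals satisfy the hypothesis of the inequality on the line.\<close>

theorem prekopa_leindler_PiM:
  fixes f g h :: "('i \<Rightarrow> real) \<Rightarrow> ennreal"
  assumes "finite I"
    and "f \<in> borel_measurable (\<Pi>\<^sub>M i\<in>I. lborel)" "g \<in> borel_measurable (\<Pi>\<^sub>M i\<in>I. lborel)"
      "h \<in> borel_measurable (\<Pi>\<^sub>M i\<in>I. lborel)"
    and "\<And>x y. x \<in> extensional I \<Longrightarrow> y \<in> extensional I \<Longrightarrow>
      f x * g y \<le> (h (\<lambda>i\<in>I. (x i + y i) / 2))\<^sup>2"
  shows "(\<integral>\<^sup>+x. f x \<partial>(\<Pi>\<^sub>M i\<in>I. lborel)) * (\<integral>\<^sup>+x. g x \<partial>(\<Pi>\<^sub>M i\<in>I. lborel))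
       \<le> (\<integral>\<^sup>+x. h x \<partial>(\<Pi>\<^sub>M i\<in>I. lborel))\<^sup>2"
  using assms
proof (induction I arbitrary: f g h rule: finite_induct)
  case empty
  interpret product_sigma_finite "\<lambda>_::'i. lborel :: real measure" ..
  show ?case
    using empty(4)[of "\<lambda>_. undefined" "\<lambda>_. undefined"]
    by (simp add: PiM_empty nn_integral_count_space_finite restrict_def)
next
  case (insert i I)
  interpret product_sigma_finite "\<lambda>_::'i. lborel :: real measure" ..
  interpret I: sigma_finite_measure "\<Pi>\<^sub>M i\<in>I. lborel :: real measure"
    by (rule sigma_finite[OF insert(1)])
  note [measurable] = insert.prems(1-3)
  let ?P = "\<Pi>\<^sub>M i\<in>I. lborel :: real measure"
  have slice [measurable]: "(\<lambda>x. u (x(i := t))) \<in> borel_measurable ?P"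
    if [measurable]: "u \<in> borel_measurable (\<Pi>\<^sub>M i\<in>insert i I. lborel)"
    for u :: "('i \<Rightarrow> real) \<Rightarrow> ennreal" and t
    by measurable
  have slices [measurable]: "(\<lambda>t. \<integral>\<^sup>+x. u (x(i := t)) \<partial>?P) \<in> borel_measurable borel"
    if [measurable]: "u \<in> borel_measurable (\<Pi>\<^sub>M i\<in>insert i I. lborel)"
    for u :: "('i \<Rightarrow> real) \<Rightarrow> ennreal"
    by measurable
  have "(\<integral>\<^sup>+t. (\<integral>\<^sup>+x. f (x(i := t)) \<partial>?P) \<partial>lborel) * (\<integral>\<^sup>+t. (\<integral>\<^sup>+x. g (x(i := t)) \<partial>?P) \<partial>lborel)
      \<le> (\<integral>\<^sup>+t. (\<integral>\<^sup>+x. h (x(i := t)) \<partial>?P) \<partial>lborel)\<^sup>2"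
  proof (rule prekopa_leindler_line)
    fix s t :: real
    show "(\<integral>\<^sup>+x. f (x(i := s)) \<partial>?P) * (\<integral>\<^sup>+x. g (x(i := t)) \<partial>?P)
        \<le> (\<integral>\<^sup>+x. h (x(i := (s + t) / 2)) \<partial>?P)\<^sup>2"
    proof (rule insert.IH)
      fix x y :: "'i \<Rightarrow> real" assume xy: "x \<in> extensional I" "y \<in> extensional I"
      have "(\<lambda>j\<in>insert i I. ((x(i := s)) j + (y(i := t)) j) / 2)
          = (\<lambda>j\<in>I. (x j + y j) / 2)(i := (s + t) / 2)"
        using insert(2) by (auto simp: fun_eq_iff)
      moreover have "x(i := s) \<in> extensional (insert i I)" "y(i := t) \<in> extensional (insert i I)"
        using xy by (auto simp: extensional_def)
      ultimately show "f (x(i := s)) * g (y(i := t))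
          \<le> (h ((\<lambda>j\<in>I. (x j + y j) / 2)(i := (s + t) / 2)))\<^sup>2"
        using insert.prems(4)[of "x(i := s)" "y(i := t)"] by (simp only:)
    qed (rule slice; fact)+
  qed (rule slices; fact)+
  then show ?case
    by (simp add: product_nn_integral_insert_rev insert)
qed

text \<open>The multiplicative Brunn--Minkowski inequality: the case of indicator functions.\<close>

corollary midpoint_set_PiM:
  fixes A B C :: "('i \<Rightarrow> real) set"
  assumes "finite I"
    and [measurable]: "A \<in> sets (\<Pi>\<^sub>M i\<in>I. lborel)" "B \<in> sets (\<Pi>\<^sub>M i\<in>I. lborel)"
      "C \<in> sets (\<Pi>\<^sub>M i\<in>I. lborel)"
    and mid: "\<And>x y. x \<in> A \<Longrightarrow> y \<in> B \<Longrightarrow> (\<lambda>i\<in>I. (x i + y i) / 2) \<in> C"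
  shows "emeasure (\<Pi>\<^sub>M i\<in>I. lborel) A * emeasure (\<Pi>\<^sub>M i\<in>I. lborel) B
       \<le> (emeasure (\<Pi>\<^sub>M i\<in>I. lborel) C)\<^sup>2"
proof -
  have "indicator A x * indicator B y \<le> (indicator C (\<lambda>i\<in>I. (x i + y i) / 2) :: ennreal)\<^sup>2" for x y
    using mid[of x y] by (auto simp: indicator_def simp del: restrict_apply)
  then show ?thesis
    using prekopa_leindler_PiM[OF assms(1), of "indicator A" "indicator B" "indicator C"] by simp
qed

section \<open>Lower tails of log-concave distribution functions\<close>

text \<open>For a log-concave function the ratios of consecutive values along an arithmetic progression running to the
left can only decrease, so one ratio at most \<open>q\<close> bounds all later ones. If a value vanishes, division is
impossible, and monotonicity takes over.\<close>

lemma midpoint_log_concave_geometric_decay: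
  fixes F :: "real \<Rightarrow> real"
  assumes "mono F" and nonneg: "\<And>t. 0 \<le> F t" and le1: "F b \<le> 1"
    and mid: "\<And>s t. F s * F t \<le> (F ((s + t) / 2))\<^sup>2"
    and d: "0 \<le> d" and q: "0 \<le> q" "F (b - d) \<le> q * F b"
  shows "F (b - real k * d) \<le> q ^ k"
proof -
  have step: "F (b - real (Suc k) * d) \<le> q * F (b - real k * d)" for k
  proof (induction k)
    case 0
    then show ?case using q by simp
  next
    case (Suc k)
    define x y z where "x = F (b - real k * d)" and "y = F (b - real (Suc k) * d)"
      and "z = F (b - real (Suc (Suc k)) * d)"
    have IH: "y \<le> q * x" using Suc by (simp add: x_def y_def)
    have nn: "0 \<le> x" "0 \<le> y" "0 \<le> z" by (simp_all add: x_def y_def z_def nonneg)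
    have "((b - real (Suc (Suc k)) * d) + (b - real k * d)) / 2 = b - real (Suc k) * d"
      by (simp add: field_simps)
    then have "z * x \<le> y\<^sup>2"
      using mid[of "b - real (Suc (Suc k)) * d" "b - real k * d"] by (simp only: x_def y_def z_def)
    also have "\<dots> \<le> (q * y) * x" using mult_left_mono[OF IH nn(2)] by (simp add: power2_eq_square mult_ac)
    finally have zx: "z * x \<le> (q * y) * x" .
    have "z \<le> x" unfolding x_def z_def
      using d by (intro monoD[OF \<open>mono F\<close>]) (simp add: algebra_simps)
    then have "z \<le> q * y"
      using zx nn q(1) by (cases "x = 0") auto
    then show ?case by (simp add: y_def z_def)
  qed
  show ?thesis
  proof (induction k)
    case 0
    then show ?case using le1 by simp
  next
    case (Suc k)
    have "F (b - real (Suc k) * d) \<le> q * F (b - real k * d)" by (rule step)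
    also have "\<dots> \<le> q * q ^ k" using Suc q by (intro mult_left_mono)
    finally show ?case by simp
  qed
qed

text \<open>Chebyshev's inequality puts mass at most \<open>1 / 4\<close> below \<open>m - 2 * \<sigma>\<close> and at least \<open>3 / 4\<close> below \<open>m + 2 * \<sigma>\<close>, where
\<open>m\<close> is the mean. Log-concavity of the distribution function propagates this ratio \<open>1 / 3\<close> at steps of \<open>4 * \<sigma>\<close>
to the left, whereas the integrand gains a factor of only \<open>exp (1 / 2) \<le> 2\<close> per step. The expectation is
therefore bounded by a geometric series of ratio \<open>2 / 3\<close>, whatever the scale \<open>\<sigma>\<close>.\<close>

lemma (in prob_space) exp_lower_deviation_bound:
  fixes Y :: "'a \<Rightarrow> real"
  assumes [measurable]: "Y \<in> borel_measurable M" and Y0: "\<And>x. 0 \<le> Y x"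
    and int: "integrable M (\<lambda>x. (Y x)\<^sup>2)"
    and \<sigma>: "0 < \<sigma>" "\<sigma>\<^sup>2 = variance Y"
    and mid: "\<And>s t. prob {x\<in>space M. Y x \<le> s} * prob {x\<in>space M. Y x \<le> t}
        \<le> (prob {x\<in>space M. Y x \<le> (s + t) / 2})\<^sup>2"
  shows "integrable M (\<lambda>x. exp (max 0 (expectation Y - Y x) / (8 * \<sigma>)))"
    and "expectation (\<lambda>x. exp (max 0 (expectation Y - Y x) / (8 * \<sigma>))) \<le> 6"
proof -
  define m where "m = expectation Y"
  define F where "F t = prob {x\<in>space M. Y x \<le> t}" for t
  define V where "V x = max 0 (m - Y x)" for x
  have m0: "0 \<le> m" unfolding m_def using Y0 by simp
  have V: "0 \<le> V x" "V x \<le> m" for x using m0 Y0[of x] by (auto simp: V_def)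
  have [measurable]: "V \<in> borel_measurable M" unfolding V_def by measurable
  have int_exp: "integrable M (\<lambda>x. exp (V x / (8 * \<sigma>)))"
    by (rule integrable_const_bound[of _ "exp (m / (8 * \<sigma>))"])
       (use V \<sigma> in \<open>auto intro!: divide_right_mono\<close>)
  have cheb: "prob {x\<in>space M. 2 * \<sigma> \<le> \<bar>Y x - m\<bar>} \<le> 1 / 4"
    using Chebyshev_inequality[OF _ int, of "2 * \<sigma>"] \<sigma>(1)
    by (simp add: m_def power_mult_distrib flip: \<sigma>(2))
  have low: "F (m - 2 * \<sigma>) \<le> 1 / 4"
    unfolding F_def by (rule order_trans[OF finite_measure_mono cheb]) auto
  have high: "3 / 4 \<le> F (m + 2 * \<sigma>)"
  proof -
    have "1 - F (m + 2 * \<sigma>) = prob {x\<in>space M. \<not> Y x \<le> m + 2 * \<sigma>}"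
      unfolding F_def by (subst prob_neg) auto
    also have "\<dots> \<le> 1 / 4"
      by (rule order_trans[OF finite_measure_mono cheb]) auto
    finally show ?thesis by simp
  qed
  have tail: "F (m + 2 * \<sigma> - real k * (4 * \<sigma>)) \<le> (1 / 3) ^ k" for k
  proof (rule midpoint_log_concave_geometric_decay)
    show "mono F" unfolding F_def by (intro monoI finite_measure_mono) auto
    show "F s * F t \<le> (F ((s + t) / 2))\<^sup>2" for s t unfolding F_def by (rule mid)
    show "F (m + 2 * \<sigma> - 4 * \<sigma>) \<le> 1 / 3 * F (m + 2 * \<sigma>)" using low high by simp
  qed (use \<sigma> in \<open>auto simp: F_def\<close>)
  \<comment> \<open>The deviation \<open>V\<close> is at most \<open>m\<close>, so \<open>A k\<close> is empty for \<open>N \<le> k\<close>.\<close>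
  define N where "N = Suc (nat \<lfloor>(m + 2 * \<sigma>) / (4 * \<sigma>)\<rfloor>)"
  define A where "A k = {x\<in>space M. real k * (4 * \<sigma>) \<le> V x + 2 * \<sigma>}" for k
  have [measurable]: "A k \<in> sets M" for k unfolding A_def by measurable
  have prob_A: "prob (A k) \<le> (1 / 3) ^ k" for k
  proof (cases "k = 0")
    case False
    then have "1 \<le> real k" by simp
    then have "4 * \<sigma> \<le> real k * (4 * \<sigma>)" using \<sigma> by simp
    then have "A k \<subseteq> {x\<in>space M. Y x \<le> m + 2 * \<sigma> - real k * (4 * \<sigma>)}"
      using \<sigma> by (auto simp: A_def V_def max_def split: if_splits)
    then have "prob (A k) \<le> F (m + 2 * \<sigma> - real k * (4 * \<sigma>))"
      unfolding F_def by (intro finite_measure_mono) auto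
    then show ?thesis using tail[of k] by simp
  qed simp
  have pointwise: "exp (V x / (8 * \<sigma>)) \<le> exp (1 / 4) * (\<Sum>k<N. exp (1 / 2) ^ k * indicator (A k) x)"
    if x: "x \<in> space M" for x
  proof -
    define r where "r = (V x + 2 * \<sigma>) / (4 * \<sigma>)"
    define k where "k = nat \<lfloor>r\<rfloor>"
    have r: "0 \<le> r" "r \<le> (m + 2 * \<sigma>) / (4 * \<sigma>)"
      using V[of x] \<sigma> by (auto simp: r_def intro!: divide_right_mono)
    have k: "real k \<le> r" "r < real k + 1" using r unfolding k_def by linarith+
    have "k < N" unfolding k_def N_def using r by (simp add: less_Suc_eq_le nat_mono floor_mono)
    have "x \<in> A k" using k(1) \<sigma> x by (simp add: A_def r_def field_simps)
    have "V x / (8 * \<sigma>) = r / 2 - 1 / 4" using \<sigma> by (simp add: r_def field_simps)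
    also have "\<dots> \<le> 1 / 4 + real k * (1 / 2)" using k by simp
    finally have "exp (V x / (8 * \<sigma>)) \<le> exp (1 / 4) * exp (1 / 2) ^ k"
      by (simp add: exp_add[symmetric] exp_of_nat_mult[symmetric])
    also have "exp (1 / 2) ^ k = exp (1 / 2) ^ k * indicator (A k) x"
      using \<open>x \<in> A k\<close> by simp
    also have "exp (1 / 4) * (exp (1 / 2) ^ k * indicator (A k) x)
        \<le> exp (1 / 4) * (\<Sum>k<N. exp (1 / 2) ^ k * indicator (A k) x :: real)"
      using \<open>k < N\<close> by (intro mult_left_mono member_le_sum) auto
    finally show ?thesis .
  qed
  have e2: "exp (1 / 2 :: real) \<le> 2"
  proof -
    have "(exp (1 / 2 :: real))\<^sup>2 \<le> 2\<^sup>2" using exp_le by (simp add: power2_eq_square flip: exp_add)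
    then show ?thesis by (rule power2_le_imp_le) simp
  qed
  have e4: "exp (1 / 4 :: real) \<le> 2"
    using e2 exp_le_cancel_iff[of "1/4" "1/2::real"] by linarith
  have int_ind: "integrable M (indicat_real (A k))" for k
    by (rule integrable_real_indicator) (auto simp: emeasure_eq_measure)
  have "expectation (\<lambda>x. exp (V x / (8 * \<sigma>)))
      \<le> expectation (\<lambda>x. exp (1 / 4) * (\<Sum>k<N. exp (1 / 2) ^ k * indicator (A k) x))"
    by (intro integral_mono int_exp pointwise integrable_mult_right Bochner_Integration.integrable_sum int_ind)
  also have "\<dots> = exp (1 / 4) * (\<Sum>k<N. exp (1 / 2) ^ k * prob (A k))"
    by (simp add: int_ind del: sum_mult_indicator)
  also have "\<dots> \<le> 2 * (\<Sum>k<N. (2 / 3) ^ k)"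
  proof (intro mult_mono e4 sum_mono sum_nonneg)
    fix k
    have "exp (1 / 2) ^ k * prob (A k) \<le> 2 ^ k * (1 / 3) ^ k"
      by (intro mult_mono power_mono e2 prob_A) auto
    then show "exp (1 / 2) ^ k * prob (A k) \<le> (2 / 3) ^ k" by (simp flip: power_mult_distrib)
  qed auto
  also have "\<dots> \<le> 6"
    by (subst sum_gp_strict) simp
  finally show "expectation (\<lambda>x. exp (max 0 (expectation Y - Y x) / (8 * \<sigma>))) \<le> 6"
    by (simp add: V_def m_def)
  show "integrable M (\<lambda>x. exp (max 0 (expectation Y - Y x) / (8 * \<sigma>)))"
    using int_exp by (simp add: V_def m_def)
qed

text \<open>With \<open>m\<close> the mean, \<open>m\<^sup>2 - Y\<^sup>2\<close> is at most \<open>2 * m\<close> times the lower deviation \<open>V\<close> of \<open>Y\<close>. So the exponential moment of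
\<open>V\<close> at \<open>w * m\<close> has to be bounded. The condition on \<open>w\<close> makes this a fraction \<open>p \<le> 1\<close> of the exponent
\<open>1 / (8 * \<sigma>)\<close>, where the moment is at most \<open>6\<close>. Convexity of \<open>exp\<close> bounds the moment by
\<open>(1 - p) + 6 * p \<le> exp (5 * p)\<close>, so the error in the exponent is linear in \<open>w * m * \<sigma>\<close>.\<close>

lemma (in prob_space) ln_expectation_exp_neg_square_le:
  fixes Y :: "'a \<Rightarrow> real"
  assumes [measurable]: "Y \<in> borel_measurable M" and Y0: "\<And>x. 0 \<le> Y x"
    and int: "integrable M (\<lambda>x. (Y x)\<^sup>2)"
    and \<sigma>: "0 < \<sigma>" "\<sigma>\<^sup>2 = variance Y"
    and mid: "\<And>s t. prob {x\<in>space M. Y x \<le> s} * prob {x\<in>space M. Y x \<le> t}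
        \<le> (prob {x\<in>space M. Y x \<le> (s + t) / 2})\<^sup>2"
    and w: "0 < w" "w * expectation Y \<le> 1 / (8 * \<sigma>)"
  shows "ln (expectation (\<lambda>x. exp (- (w / 2) * (Y x)\<^sup>2)))
      \<le> - (w / 2) * (expectation Y)\<^sup>2 + 40 * w * expectation Y * \<sigma>"
proof -
  define m where "m = expectation Y"
  define U where "U x = max 0 (m - Y x) / (8 * \<sigma>)" for x
  define p where "p = 8 * \<sigma> * (w * m)"
  have m0: "0 \<le> m" unfolding m_def using Y0 by simp
  have p: "0 \<le> p" "p \<le> 1"
    using w \<sigma> m0 by (auto simp: p_def m_def field_simps)
  have U: "integrable M (\<lambda>x. exp (U x))" "expectation (\<lambda>x. exp (U x)) \<le> 6"
    using exp_lower_deviation_bound[OF assms(1-6)] by (simp_all add: U_def m_def)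
  have int_sq: "integrable M (\<lambda>x. exp (- (w / 2) * (Y x)\<^sup>2))"
    by (rule integrable_const_bound[of _ 1]) (use w in auto)
  have pointwise: "exp (- (w / 2) * (Y x)\<^sup>2)
      \<le> exp (- (w / 2) * m\<^sup>2) * ((1 - p) + p * exp (U x))" for x
  proof -
    have "m\<^sup>2 - (Y x)\<^sup>2 \<le> 2 * m * max 0 (m - Y x)"
    proof (cases "Y x \<le> m")
      case True
      have "2 * m * (m - Y x) - (m\<^sup>2 - (Y x)\<^sup>2) = (m - Y x)\<^sup>2"
        by (simp add: power2_eq_square algebra_simps)
      moreover have "0 \<le> (m - Y x)\<^sup>2" by simp
      ultimately have "m\<^sup>2 - (Y x)\<^sup>2 \<le> 2 * m * (m - Y x)" by linarith
      then show ?thesis using True by (simp add: max_def)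
    next
      case False
      then have "m\<^sup>2 \<le> (Y x)\<^sup>2" using m0 by (intro power_mono) auto
      then show ?thesis using False by (simp add: max_def)
    qed
    then have "(w / 2) * (m\<^sup>2 - (Y x)\<^sup>2) \<le> (w / 2) * (2 * m * max 0 (m - Y x))"
      using w by (intro mult_left_mono) auto
    also have "\<dots> = p * U x" using \<sigma> by (simp add: p_def U_def)
    finally have "exp (- (w / 2) * (Y x)\<^sup>2) \<le> exp (- (w / 2) * m\<^sup>2) * exp (p * U x)"
      by (simp add: exp_add[symmetric] algebra_simps)
    also have "exp (p * U x) \<le> (1 - p) + p * exp (U x)"
      using convex_onD[OF exp_convex, of p 0 "U x"] p by simp
    finally show ?thesis by simp
  qed
  have "expectation (\<lambda>x. exp (- (w / 2) * (Y x)\<^sup>2))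
      \<le> expectation (\<lambda>x. exp (- (w / 2) * m\<^sup>2) * ((1 - p) + p * exp (U x)))"
    by (intro integral_mono int_sq pointwise) (use U in auto)
  also have "\<dots> = exp (- (w / 2) * m\<^sup>2) * ((1 - p) + p * expectation (\<lambda>x. exp (U x)))"
    using U(1) prob_space by simp
  also have "\<dots> \<le> exp (- (w / 2) * m\<^sup>2) * exp (5 * p)"
  proof (intro mult_left_mono)
    have "(1 - p) + p * expectation (\<lambda>x. exp (U x)) \<le> (1 - p) + p * 6"
      using p U(2) by (intro add_left_mono mult_left_mono)
    also have "\<dots> \<le> exp (5 * p)" using exp_ge_add_one_self[of "5 * p"] by linarith
    finally show "(1 - p) + p * expectation (\<lambda>x. exp (U x)) \<le> exp (5 * p)" .
  qed simp
  finally have le: "expectation (\<lambda>x. exp (- (w / 2) * (Y x)\<^sup>2)) \<le> exp (- (w / 2) * m\<^sup>2 + 5 * p)"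
    by (simp only: exp_add)
  have pos: "0 < expectation (\<lambda>x. exp (- (w / 2) * (Y x)\<^sup>2))"
    using integral_less_AE_space[of "\<lambda>_. 0" "\<lambda>x. exp (- (w / 2) * (Y x)\<^sup>2)"] int_sq
    by (simp add: emeasure_space_1)
  have "ln (expectation (\<lambda>x. exp (- (w / 2) * (Y x)\<^sup>2))) \<le> - (w / 2) * m\<^sup>2 + 5 * p"
    using le pos by (metis exp_le_cancel_iff exp_ln)
  then show ?thesis by (simp add: p_def m_def algebra_simps)
qed

section \<open>Uniform measures on bounded convex domains\<close>

text \<open>An open set of full functions is measurable because there are only countably many coordinates. Pulling \<open>K\<close>
back along the restriction to \<open>{..<n}\<close> produces such a set, and pulling that back along the extension by
zero returns \<open>K\<close>.\<close>

lemma openin_euclid_top_measurable: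
  assumes "openin (euclid_top n) K"
  shows "K \<in> sets (lborel_n n)"
proof -
  define U where "U = {f :: nat \<Rightarrow> real. restrict f {..<n} \<in> K}"
  have "continuous_map (product_topology (\<lambda>_. euclideanreal) UNIV) (euclid_top n)
      (\<lambda>f. restrict f {..<n})"
    unfolding euclid_top_def continuous_map_componentwise
    by (auto intro!: continuous_map_product_projection)
  from openin_continuous_map_preimage[OF this assms] have "open U"
    by (simp add: U_def open_fun_def)
  then have "U \<in> sets (\<Pi>\<^sub>M i\<in>UNIV. borel)"
    by (simp add: sets_PiM_equal_borel)
  moreover have "(\<lambda>x i. if i < n then x i else 0) \<in> measurable (lborel_n n) (\<Pi>\<^sub>M i\<in>UNIV. borel)"
  proof -
    have "(\<lambda>x. \<lambda>i\<in>UNIV. if i < n then x i else 0) \<in> measurable (lborel_n n) (\<Pi>\<^sub>M i\<in>UNIV. borel :: real measure)"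
    proof (rule measurable_restrict)
      fix i :: nat
      show "(\<lambda>x. if i < n then x i else 0) \<in> measurable (lborel_n n) (borel :: real measure)"
        unfolding lborel_n_def by (cases "i < n") auto
    qed
    then show ?thesis by (simp only: restrict_UNIV)
  qed
  ultimately have "(\<lambda>x i. if i < n then x i else 0) -` U \<inter> space (lborel_n n) \<in> sets (lborel_n n)"
    by (rule measurable_sets[rotated])
  moreover have "(\<lambda>x i. if i < n then x i else 0) -` U \<inter> space (lborel_n n) = K"
  proof -
    have "K \<subseteq> extensional {..<n}"
      using openin_subset[OF assms] by (auto simp: euclid_top_def PiE_def)
    moreover have "(\<lambda>i\<in>{..<n}. if i < n then x i else 0) = x" if "x \<in> extensional {..<n}" for x :: "nat \<Rightarrow> real"
      using that by (auto simp: extensional_def fun_eq_iff)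
    ultimately show ?thesis
      by (auto simp: U_def lborel_n_def space_PiM PiE_def)
  qed
  ultimately show ?thesis by simp
qed

lemma emeasure_openin_euclid_top_pos:
  assumes K: "openin (euclid_top n) K" and "K \<noteq> {}"
  shows "0 < emeasure (lborel_n n) K"
proof -
  interpret product_sigma_finite "\<lambda>_::nat. lborel :: real measure" ..
  obtain x where "x \<in> K" using \<open>K \<noteq> {}\<close> by blast
  then have "\<exists>U. finite {i \<in> {..<n}. U i \<noteq> topspace euclideanreal} \<and>
      (\<forall>i\<in>{..<n}. openin euclideanreal (U i)) \<and> x \<in> Pi\<^sub>E {..<n} U \<and> Pi\<^sub>E {..<n} U \<subseteq> K"
    using K unfolding euclid_top_def openin_product_topology_alt by blast
  then obtain U where openin: "\<forall>i\<in>{..<n}. openin euclideanreal (U i)"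
    and U: "x \<in> Pi\<^sub>E {..<n} U" "Pi\<^sub>E {..<n} U \<subseteq> K"
    by blast
  have open_U: "open (U i)" if "i < n" for i
    using openin that by (subst open_openin) blast
  have "emeasure lborel (U i) \<noteq> 0" if i: "i < n" for i
  proof -
    have "x i \<in> U i" using U(1) i by auto
    then obtain e where e: "0 < e" "ball (x i) e \<subseteq> U i"
      using open_U[OF i] open_contains_ball by blast
    have "0 < emeasure lborel (ball (x i) e)"
      using e(1) by (simp add: ball_eq_greaterThanLessThan)
    also have "\<dots> \<le> emeasure lborel (U i)"
      using e(2) open_U[OF i] by (intro emeasure_mono) auto
    finally show ?thesis by simp
  qed
  then have "0 < (\<Prod>i<n. emeasure lborel (U i))" by (simp add: zero_less_iff_neq_zero)
  also have "\<dots> = emeasure (lborel_n n) (Pi\<^sub>E {..<n} U)"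
    unfolding lborel_n_def using open_U by (subst emeasure_PiM) auto
  also have "\<dots> \<le> emeasure (lborel_n n) K"
    by (intro emeasure_mono U openin_euclid_top_measurable K)
  finally show ?thesis .
qed

lemma emeasure_bounded_n_finite:
  assumes "bounded_n n K" and K: "openin (euclid_top n) K"
  shows "emeasure (lborel_n n) K < top"
proof -
  interpret product_sigma_finite "\<lambda>_::nat. lborel :: real measure" ..
  obtain R where R: "\<And>x. x \<in> K \<Longrightarrow> enorm n x \<le> R" using assms(1) by (auto simp: bounded_n_def)
  have "K \<subseteq> Pi\<^sub>E {..<n} (\<lambda>_. {- R..R})"
  proof
    fix x assume x: "x \<in> K"
    have "\<bar>x i\<bar> \<le> R" if "i < n" for i
    proof -
      have "\<bar>x i\<bar> \<le> L2_set (\<lambda>i. \<bar>x i\<bar>) {..<n}" using that by (intro member_le_L2_set) auto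
      also have "\<dots> = enorm n x" by (simp add: enorm_def L2_set_def)
      finally show ?thesis using R[OF x] by simp
    qed
    then show "x \<in> Pi\<^sub>E {..<n} (\<lambda>_. {- R..R})"
      using openin_subset[OF K] x by (auto simp: euclid_top_def PiE_def abs_le_iff minus_le_iff)
  qed
  then have "emeasure (lborel_n n) K \<le> emeasure (lborel_n n) (Pi\<^sub>E {..<n} (\<lambda>_. {- R..R}))"
    by (intro emeasure_mono) (auto simp: lborel_n_def intro!: sets_PiM_I_finite)
  also have "\<dots> = (\<Prod>i<n. emeasure lborel {- R..R})"
    unfolding lborel_n_def by (subst emeasure_PiM) auto
  also have "\<dots> < top" by (simp add: power_less_top_ennreal emeasure_lborel_Icc_eq)
  finally show ?thesis .
qed

lemma borel_measurable_enorm [measurable]: "enorm n \<in> borel_measurable (lborel_n n)"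
  unfolding enorm_def[abs_def] L2_set_def lborel_n_def by measurable

lemma enorm_midpoint_le:
  "enorm n (\<lambda>i\<in>{..<n}. (x i + y i) / 2) \<le> (enorm n x + enorm n y) / 2"
proof -
  have "enorm n (\<lambda>i\<in>{..<n}. (x i + y i) / 2) = L2_set (\<lambda>i. 1 / 2 * (x i + y i)) {..<n}"
    unfolding enorm_def by (intro L2_set_cong) auto
  also have "\<dots> = 1 / 2 * L2_set (\<lambda>i. x i + y i) {..<n}"
    by (rule L2_set_right_distrib[symmetric]) simp
  also have "\<dots> \<le> (enorm n x + enorm n y) / 2"
    using L2_set_triangle_ineq[of x y "{..<n}"] by (simp add: enorm_def)
  finally show ?thesis .
qed

text \<open>The distribution function of \<open>|X|\<close> is log-concave: by convexity of \<open>K\<close> and of the norm, the midpoints of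
points of \<open>K\<close> in the balls of radii \<open>s\<close> and \<open>t\<close> about the origin lie in \<open>K\<close> and in the ball of
radius \<open>(s + t) / 2\<close>. The origin may lie outside \<open>K\<close>.\<close>

theorem unif_centred_balls_midpoint_log_concave:
  fixes s t :: real
  assumes K: "openin (euclid_top n) K" "K \<noteq> {}" and conv: "convex_n n K" and bdd: "bounded_n n K"
  defines "P \<equiv> \<lambda>r. measure (unif n K) {x\<in>space (unif n K). enorm n x \<le> r}"
  shows "P s * P t \<le> (P ((s + t) / 2))\<^sup>2"
proof -
  have [measurable]: "K \<in> sets (lborel_n n)" by (rule openin_euclid_top_measurable[OF K(1)])
  define A where "A r = K \<inter> {x\<in>space (lborel_n n). enorm n x \<le> r}" for r
  have A_meas: "A r \<in> sets (lborel_n n)" for r unfolding A_def by measurable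
  have fin: "emeasure (lborel_n n) K < top" by (rule emeasure_bounded_n_finite[OF bdd K(1)])
  have A_fin: "emeasure (lborel_n n) (A r) < top" for r
    by (rule le_less_trans[OF emeasure_mono fin]) (auto simp: A_def)
  have P: "P r = measure (lborel_n n) (A r) / measure (lborel_n n) K" for r
    unfolding P_def unif_def A_def
    using emeasure_openin_euclid_top_pos[OF K] fin by (subst measure_uniform_measure) auto
  have "emeasure (lborel_n n) (A s) * emeasure (lborel_n n) (A t)
      \<le> (emeasure (lborel_n n) (A ((s + t) / 2)))\<^sup>2"
    using A_meas unfolding lborel_n_def
  proof (intro midpoint_set_PiM)
    fix x y assume x: "x \<in> A s" and y: "y \<in> A t"
    let ?z = "\<lambda>i\<in>{..<n}. (x i + y i) / 2"
    have "?z = (\<lambda>i\<in>{..<n}. (1 - 1/2) * x i + 1/2 * y i)" by (auto simp: fun_eq_iff field_simps)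
    also have "\<dots> \<in> K"
      using conv[unfolded convex_n_def, rule_format, of x y "1 / 2"] x y by (simp only: A_def) simp
    finally have "?z \<in> K" .
    moreover have "enorm n ?z \<le> (s + t) / 2"
      using enorm_midpoint_le[of n x y] x y by (simp add: A_def)
    moreover have "?z \<in> space (lborel_n n)" by (simp add: lborel_n_def space_PiM)
    ultimately show "?z \<in> A ((s + t) / 2)" by (simp add: A_def)
  qed auto
  then have "ennreal (measure (lborel_n n) (A s) * measure (lborel_n n) (A t))
      \<le> ennreal ((measure (lborel_n n) (A ((s + t) / 2)))\<^sup>2)"
    using A_fin by (simp add: emeasure_eq_ennreal_measure ennreal_mult ennreal_power less_top)
  then have "measure (lborel_n n) (A s) * measure (lborel_n n) (A t)
      \<le> (measure (lborel_n n) (A ((s + t) / 2)))\<^sup>2"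
    by (subst (asm) ennreal_le_iff) auto
  then have "measure (lborel_n n) (A s) * measure (lborel_n n) (A t) / (measure (lborel_n n) K)\<^sup>2
      \<le> (measure (lborel_n n) (A ((s + t) / 2)))\<^sup>2 / (measure (lborel_n n) K)\<^sup>2"
    by (rule divide_right_mono) simp
  then show ?thesis unfolding P by (simp add: power2_eq_square)
qed

section \<open>The lower bound for the logarithmic Laplace transform\<close>

theorem theorem3p4:
  "\<exists>c C :: real. c > 0 \<and> C > 0 \<and>
     (\<forall>n :: nat. \<forall>K :: (nat \<Rightarrow> real) set. \<forall>w :: real.
        n \<ge> 1 \<longrightarrow> domain_n n K \<longrightarrow> convex_n n K \<longrightarrow> bounded_n n K \<longrightarrow> w > 0 \<longrightarrow>
        w \<le> c / (E2 n K * S n K) \<longrightarrow>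
        Z n K w / w \<ge> 1 / 2 * (E2 n K)\<^sup>2 - C * (E2 n K * S n K))"
proof (rule exI[of _ "1 / 8"], rule exI[of _ 41], intro conjI allI impI)
  fix n K and w :: real
  assume "domain_n n K" and conv: "convex_n n K" and bdd: "bounded_n n K"
    and w: "0 < w" "w \<le> 1 / 8 / (E2 n K * S n K)"
  then have K: "openin (euclid_top n) K" "K \<noteq> {}" by (auto simp: domain_n_def)
  have K_meas [measurable]: "K \<in> sets (lborel_n n)" by (rule openin_euclid_top_measurable[OF K(1)])
  interpret prob_space "unif n K"
    unfolding unif_def
    using emeasure_openin_euclid_top_pos[OF K] emeasure_bounded_n_finite[OF bdd K(1)]
    by (intro prob_space_uniform_measure) auto
  have enorm_meas: "enorm n \<in> borel_measurable (unif n K)"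
    unfolding unif_def by measurable
  have enorm_nonneg: "0 \<le> enorm n x" for x by (simp add: enorm_def)
  obtain R where R: "\<And>x. x \<in> K \<Longrightarrow> enorm n x \<le> R" using bdd by (auto simp: bounded_n_def)
  have AE_K: "AE x in unif n K. x \<in> K"
    unfolding unif_def by (rule AE_uniform_measureI) auto
  have sq: "integrable (unif n K) (\<lambda>x. (enorm n x)\<^sup>2)"
  proof (rule integrable_const_bound[of _ "R\<^sup>2"])
    show "AE x in unif n K. norm ((enorm n x)\<^sup>2) \<le> R\<^sup>2"
      using AE_K by eventually_elim (simp add: power_mono R enorm_nonneg)
  qed (use enorm_meas in measurable)
  have int: "integrable (unif n K) (enorm n)"
    by (rule square_integrable_imp_integrable[OF enorm_meas sq])
  define m where "m = expectation (enorm n)"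
  define e where "e = E2 n K"
  define \<sigma> where "\<sigma> = S n K"
  have m: "0 \<le> m" unfolding m_def by (simp add: enorm_nonneg)
  have e: "0 \<le> e" "e\<^sup>2 = expectation (\<lambda>x. (enorm n x)\<^sup>2)" by (simp_all add: e_def E2_def)
  have \<sigma>: "0 \<le> \<sigma>" "\<sigma>\<^sup>2 = variance (enorm n)" by (simp_all add: \<sigma>_def S_def)
  have var: "\<sigma>\<^sup>2 = e\<^sup>2 - m\<^sup>2" unfolding \<sigma> e m_def by (rule variance_eq[OF int sq])
  \<comment> \<open>A vanishing product would turn the upper bound on \<open>w\<close> into \<open>1 / 8 / 0 = 0\<close>.\<close>
  have "e * \<sigma> \<noteq> 0" using w by (auto simp: e_def \<sigma>_def)
  then have pos: "0 < e" "0 < \<sigma>" using e(1) \<sigma>(1) by auto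
  have "m\<^sup>2 \<le> e\<^sup>2" "\<sigma>\<^sup>2 \<le> e\<^sup>2"
    using var zero_le_power2[of \<sigma>] zero_le_power2[of m] by linarith+
  then have "m \<le> e" "\<sigma> \<le> e" using e(1) by (auto intro: power2_le_imp_le)
  have "w * m \<le> w * e" using w \<open>m \<le> e\<close> by simp
  also have "\<dots> \<le> 1 / (8 * \<sigma>)" using w(2) pos by (simp add: e_def \<sigma>_def field_simps)
  finally have "ln (expectation (\<lambda>x. exp (- (w / 2) * (enorm n x)\<^sup>2)))
      \<le> - (w / 2) * m\<^sup>2 + 40 * w * m * \<sigma>"
    unfolding m_def
    by (intro ln_expectation_exp_neg_square_le enorm_meas enorm_nonneg sq pos \<sigma>(2) w(1)
        unif_centred_balls_midpoint_log_concave[OF K conv bdd])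
  then have "w * (m\<^sup>2 / 2 - 40 * (m * \<sigma>)) \<le> Z n K w"
    by (simp add: Z_def algebra_simps)
  then have "m\<^sup>2 / 2 - 40 * (m * \<sigma>) \<le> Z n K w / w"
    using w(1) by (simp add: pos_le_divide_eq mult.commute)
  moreover have "m * \<sigma> \<le> e * \<sigma>" using \<open>m \<le> e\<close> pos by simp
  moreover have "\<sigma>\<^sup>2 \<le> e * \<sigma>" using \<open>\<sigma> \<le> e\<close> pos by (simp add: power2_eq_square)
  moreover have "0 \<le> e * \<sigma>" using pos by simp
  \<comment> \<open>Passing from \<open>m\<^sup>2\<close> to \<open>e\<^sup>2 = m\<^sup>2 + \<sigma>\<^sup>2\<close> costs another \<open>\<sigma>\<^sup>2 / 2 \<le> e * \<sigma> / 2\<close>, hence 41 instead of 40.\<close>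
  ultimately show "1 / 2 * (E2 n K)\<^sup>2 - 41 * (E2 n K * S n K) \<le> Z n K w / w"
    using var unfolding e_def[symmetric] \<sigma>_def[symmetric] by linarith
qed auto

end
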